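(* In the multicell downlink model with transceiver impairments described in the context, assume that $\eta(\cdot)$ and $\nu(\cdot)$ are monotonically increasing convex functions. Let $a_{i,j}\ge0$ and $\alpha_{i,j}\ge0$ with $\sum_{i,j}\alpha_{i,j}=1$ be given, and consider the fairness-profile optimization problem $$(\mathrm{P2})\qquad \underset{\mathbf{W}_i\in\mathcal{W}_i\ \forall i}{\text{maximize}}\ \ \min_{i,j}\frac{g_{i,j}(\mathrm{SINR}_{i,j})-a_{i,j}}{\alpha_{i,j}}\qquad\text{subject to}\quad g_{i,j}(\mathrm{SINR}_{i,j})\ge a_{i,j}\quad\forall i,j .$$ Assume (P2) is feasible and let $f^{\mathrm{upper}}_{\mathrm{FPO}}$ be an upper bound on the optimal value of (P2). Then (P2) can be solved by bisection over the interval $\mathcal{F}=[0,f^{\mathrm{upper}}_{\mathrm{FPO}}]$ as follows. For a given $f_{\mathrm{candidate}}\in\mathcal{F}$ (the midpoint of the current $\mathcal{F}$), consider the problem $$(\mathrm{P1})\qquad \begin{aligned}\underset{\beta,\ \mathbf{W}_i\ \forall i}{\text{minimize}}\quad & \beta\\ \text{subject to}\quad & g_{i,j}(\mathrm{SINR}_{i,j})\ge\gamma_{i,j}\quad\forall i,j,\\ & \mathrm{tr}(\mathbf{W}_i^H\mathbf{Q}_{i,k}\mathbf{W}_i)+\delta\,\mathrm{tr}(\mathbf{Q}_{i,k}\mathbf{C}_i)\le\beta q_{i,k}\quad\forall i,k\end{aligned}$$ with $\gamma_{i,j}=a_{i,j}+\alpha_{i,j}f_{\mathrm{candidate}}$.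 If (P1) is feasible for these $\gamma_{i,j}$ and its optimal value satisfies $\beta_{\mathrm{solution}}\le1$, then all $\tilde f\in\mathcal{F}$ with $\tilde f<f_{\mathrm{candidate}}$ are removed from $\mathcal{F}$; otherwise all $\tilde f\in\mathcal{F}$ with $\tilde f\ge f_{\mathrm{candidate}}$ are removed. That is, at every step of this procedure the remaining set $\mathcal{F}$ contains the optimal value of (P2), so that $\mathcal{F}$ shrinks to the optimal value of (P2), and whenever a candidate is accepted, the optimal $\mathbf{W}_1,\dots,\mathbf{W}_N$ of the corresponding (P1) are feasible for (P2) and attain in (P2) an objective value of at least $f_{\mathrm{candidate}}$.
   Context: Model. There are $N$ cells, each with one base station having $N_t$ antennas and $K$ single-antenna users. $\mathbf{h}_{m,i,j}\in\mathbb{C}^{N_t}$ is the (known, fixed) channel vector from base station $m$ to user $j$ of cell $i$. $\mathbf{w}_{i,j}\in\mathbb{C}^{N_t}$ is the beamforming vector for user $j$ of cell $i$ and $\mathbf{W}_i=[\mathbf{w}_{i,1}\ \cdots\ \mathbf{w}_{i,K}]\in\mathbb{C}^{N_t\times K}$. Indices: $i,m\in\{1,\dots,N\}$, $j,l\in\{1,\dots,K\}$, $n\in\{1,\dots,N_t\}$. $(\cdot)^H$ is conjugate transpose, $\|\cdot\|_F$ the Frobenius norm. Impairments. $\mathbf{T}_n\in\mathbb{C}^{N_t\times N_t}$ has $n$th diagonal element equal to one and all other elements zero. $\eta,\nu:[0,\infty)\to[0,\infty)$ are monotonically increasing continuous functions. The transmitter-distortion covariance of base station $m$ is the diagonal matrix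 $\mathbf{C}_m=\mathrm{diag}(c_{m,1}^2,\dots,c_{m,N_t}^2)$ with $c_{m,n}=\eta(\|\mathbf{T}_n\mathbf{W}_m\|_F)$. The thermal noise power is $\sigma^2>0$, and the receiver-distortion variance is $\sigma_{i,j}^2=\sigma^2+\nu^2\big(\sqrt{\sum_{m=1}^N\|\mathbf{h}_{m,i,j}^H\mathbf{W}_m\|_F^2}\big)$, where $\nu^2(x)=(\nu(x))^2$. Power constraints. For each cell $i$ and $k=1,\dots,L_i$, $\mathbf{Q}_{i,k}\in\mathbb{C}^{N_t\times N_t}$ is positive semidefinite, with $\sum_{k=1}^{L_i}\mathbf{Q}_{i,k}\succ 0$ for every $i$; $q_{i,k}>0$ are power limits; $\delta\in[0,1]$ is a fixed parameter. The feasible set of beamforming matrices in cell $i$ is $$\mathcal{W}_i=\{\mathbf{W}_i:\ \mathrm{tr}(\mathbf{W}_i^H\mathbf{Q}_{i,k}\mathbf{W}_i)+\delta\,\mathrm{tr}(\mathbf{Q}_{i,k}\mathbf{C}_i)\le q_{i,k}\ \ \forall k\}.$$ SINR and performance. $$\mathrm{SINR}_{i,j}=\frac{|\mathbf{h}_{i,i,j}^H\mathbf{w}_{i,j}|^2}{\sum_{l\ne j}|\mathbf{h}_{i,i,j}^H\mathbf{w}_{i,l}|^2+\sum_{m\ne i}\|\mathbf{h}_{m,i,j}^H\mathbf{W}_m\|_F^2+\sum_m\mathbf{h}_{m,i,j}^H\mathbf{C}_m\mathbf{h}_{m,i,j}+\sigma_{i,j}^2}.$$ Each $g_{i,j}:[0,\infty)\to[0,\infty)$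 is strictly increasing and continuous with $g_{i,j}(0)=0$. Convention: in the minimum in (P2), pairs $(i,j)$ with $\alpha_{i,j}=0$ are left out (for them only the constraint $g_{i,j}(\mathrm{SINR}_{i,j})\ge a_{i,j}$ applies). *)

theory Defs
  imports "HOL-Analysis.Analysis"
begin

text \<open>
  Cells, users per cell and antennas are indexed by finite types \<open>'c\<close>, \<open>'u\<close>, \<open>'t\<close>
  (so \<open>N = CARD('c)\<close>, \<open>K = CARD('u)\<close>, \<open>N\<^sub>t = CARD('t)\<close>). An \<open>m \<times> n\<close> matrix has type
  \<^typ>\<open>complex^'n^'m\<close>, whose library norm is the Frobenius norm.
\<close>

definition conj_vec :: "complex^'n \<Rightarrow> complex^'n" where
  "conj_vec x = (\<chi> n. cnj (x $ n))"

definition conj_transpose :: "complex^'n^'m \<Rightarrow> complex^'m^'n" where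
  "conj_transpose A = (\<chi> i j. cnj (A $ j $ i))"

text \<open>\<open>herm_prod x y\<close> is the scalar \<open>x\<^sup>H y\<close>; the row vector \<open>x\<^sup>H A\<close> is \<open>conj_vec x v* A\<close>.\<close>

definition herm_prod :: "complex^'n \<Rightarrow> complex^'n \<Rightarrow> complex" where
  "herm_prod x y = (\<Sum>n\<in>UNIV. cnj (x $ n) * y $ n)"

definition pos_semidef :: "complex^'n^'n \<Rightarrow> bool" where
  "pos_semidef A \<longleftrightarrow> conj_transpose A = A \<and> (\<forall>x. 0 \<le> Re (herm_prod x (A *v x)))"

definition pos_def :: "complex^'n^'n \<Rightarrow> bool" where
  "pos_def A \<longleftrightarrow> conj_transpose A = A \<and> (\<forall>x. x \<noteq> 0 \<longrightarrow> 0 < Re (herm_prod x (A *v x)))"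

text \<open>
  \<open>chan S m i j\<close> is the channel from base station \<open>m\<close> to user \<open>j\<close> of cell \<open>i\<close>, and
  \<open>noise S\<close> is the noise power \<open>\<sigma>\<^sup>2\<close> itself. The constraints of cell \<open>i\<close> are
  numbered \<open>1, \<dots>, ncon S i\<close>. Scalar functions matter on \<open>[0, \<infinity>)\<close> only.
\<close>

record ('c, 'u, 't) downlink =
  chan :: "'c \<Rightarrow> 'c \<Rightarrow> 'u \<Rightarrow> complex^'t::finite"
  eta :: "real \<Rightarrow> real"
  nu :: "real \<Rightarrow> real"
  noise :: real
  ncon :: "'c \<Rightarrow> nat"
  Qmat :: "'c \<Rightarrow> nat \<Rightarrow> complex^'t^'t"
  qlim :: "'c \<Rightarrow> nat \<Rightarrow> real"
  delta :: real
  perf :: "'c \<Rightarrow> 'u \<Rightarrow> real \<Rightarrow> real"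

definition downlink_model :: "('c::finite, 'u::finite, 't::finite) downlink \<Rightarrow> bool" where
  "downlink_model S \<longleftrightarrow>
     eta S \<in> {0..} \<rightarrow> {0..} \<and> mono_on {0..} (eta S) \<and> continuous_on {0..} (eta S) \<and>
     nu S \<in> {0..} \<rightarrow> {0..} \<and> mono_on {0..} (nu S) \<and> continuous_on {0..} (nu S) \<and>
     0 < noise S \<and>
     (\<forall>i. \<forall>k\<in>{1..ncon S i}. pos_semidef (Qmat S i k) \<and> 0 < qlim S i k) \<and>
     (\<forall>i. pos_def (\<Sum>k=1..ncon S i. Qmat S i k)) \<and>
     delta S \<in> {0..1} \<and>
     (\<forall>i j. perf S i j \<in> {0..} \<rightarrow> {0..} \<and> strict_mono_on {0..} (perf S i j) \<and>
            continuous_on {0..} (perf S i j) \<and> perf S i j 0 = 0)"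

text \<open>
  In the following, \<open>V\<close> is the beamforming matrix of one cell (column \<open>j\<close> serves user \<open>j\<close>),
  and \<open>W\<close> collects the matrices of all cells, so that \<open>W $ i\<close> is the matrix of cell \<open>i\<close>.
\<close>

definition select_mat :: "'t::finite \<Rightarrow> complex^'t^'t" where
  "select_mat n = (\<chi> a b. if a = n \<and> b = n then 1 else 0)"

definition tx_dist :: "('c, 'u, 't) downlink \<Rightarrow> complex^'u::finite^'t::finite \<Rightarrow> 't \<Rightarrow> real" where
  "tx_dist S V n = eta S (norm (select_mat n ** V))"

definition tx_cov :: "('c, 'u, 't) downlink \<Rightarrow> complex^'u::finite^'t::finite \<Rightarrow> complex^'t^'t" where
  "tx_cov S V = (\<chi> a b. if a = b then of_real ((tx_dist S V a)\<^sup>2) else 0)"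

definition rx_var ::
  "('c::finite, 'u::finite, 't::finite) downlink \<Rightarrow> complex^'u^'t^'c \<Rightarrow> 'c \<Rightarrow> 'u \<Rightarrow> real" where
  "rx_var S W i j =
     noise S + (nu S (sqrt (\<Sum>m\<in>UNIV. (norm (conj_vec (chan S m i j) v* (W $ m)))\<^sup>2)))\<^sup>2"

text \<open>The quadratic form with \<open>tx_cov\<close> below is real, so \<^const>\<open>Re\<close> only changes its type.\<close>

definition SINR ::
  "('c::finite, 'u::finite, 't::finite) downlink \<Rightarrow> complex^'u^'t^'c \<Rightarrow> 'c \<Rightarrow> 'u \<Rightarrow> real" where
  "SINR S W i j =
     (cmod (herm_prod (chan S i i j) (column j (W $ i))))\<^sup>2 /
     ((\<Sum>l\<in>UNIV - {j}. (cmod (herm_prod (chan S i i j) (column l (W $ i))))\<^sup>2)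
      + (\<Sum>m\<in>UNIV - {i}. (norm (conj_vec (chan S m i j) v* (W $ m)))\<^sup>2)
      + (\<Sum>m\<in>UNIV. Re (herm_prod (chan S m i j) (tx_cov S (W $ m) *v chan S m i j)))
      + rx_var S W i j)"

text \<open>Both traces are real, since the \<open>Qmat S i k\<close> are Hermitian and \<open>tx_cov\<close> is real diagonal.\<close>

definition power_use ::
  "('c, 'u, 't) downlink \<Rightarrow> 'c \<Rightarrow> nat \<Rightarrow> complex^'u::finite^'t::finite \<Rightarrow> real" where
  "power_use S i k V =
     Re (trace (conj_transpose V ** Qmat S i k ** V))
     + delta S * Re (trace (Qmat S i k ** tx_cov S V))"

definition feasible_beams ::
  "('c, 'u, 't) downlink \<Rightarrow> 'c \<Rightarrow> (complex^'u::finite^'t::finite) set" where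
  "feasible_beams S i = {V. \<forall>k\<in>{1..ncon S i}. power_use S i k V \<le> qlim S i k}"

text \<open>
  \<open>P2\<close> maximizes the worst weighted excess performance. Pairs with \<open>\<alpha> i j = 0\<close> enter only
  through the constraint. The supremum is taken in \<^typ>\<open>real\<close>; it is meaningful because the power
  constraints bound the objective.
\<close>

definition P2_feasible ::
  "('c::finite, 'u::finite, 't::finite) downlink \<Rightarrow> ('c \<Rightarrow> 'u \<Rightarrow> real) \<Rightarrow> (complex^'u^'t^'c) set" where
  "P2_feasible S a =
     {W. (\<forall>i. W $ i \<in> feasible_beams S i) \<and> (\<forall>i j. perf S i j (SINR S W i j) \<ge> a i j)}"

definition P2_objective ::
  "('c::finite, 'u::finite, 't::finite) downlink \<Rightarrow> ('c \<Rightarrow> 'u \<Rightarrow> real) \<Rightarrow> ('c \<Rightarrow> 'u \<Rightarrow> real)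
    \<Rightarrow> complex^'u^'t^'c \<Rightarrow> real" where
  "P2_objective S a \<alpha> W =
     Min ((\<lambda>(i, j). (perf S i j (SINR S W i j) - a i j) / \<alpha> i j) ` {(i, j). \<alpha> i j \<noteq> 0})"

definition P2_value ::
  "('c::finite, 'u::finite, 't::finite) downlink \<Rightarrow> ('c \<Rightarrow> 'u \<Rightarrow> real) \<Rightarrow> ('c \<Rightarrow> 'u \<Rightarrow> real) \<Rightarrow> real" where
  "P2_value S a \<alpha> = (SUP W\<in>P2_feasible S a. P2_objective S a \<alpha> W)"

text \<open>
  \<open>P1\<close> minimizes the power scaling \<open>\<beta>\<close> subject to performance targets \<open>\<gamma>\<close>. On its feasible
  set \<open>\<beta> \<ge> 0\<close>, so the real infimum is meaningful unless that set is empty, which is why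
  \<open>accepts\<close> tests feasibility separately.
\<close>

definition P1_feasible ::
  "('c::finite, 'u::finite, 't::finite) downlink \<Rightarrow> ('c \<Rightarrow> 'u \<Rightarrow> real)
    \<Rightarrow> (real \<times> (complex^'u^'t^'c)) set" where
  "P1_feasible S \<gamma> =
     {(\<beta>, W). (\<forall>i j. perf S i j (SINR S W i j) \<ge> \<gamma> i j) \<and>
              (\<forall>i. \<forall>k\<in>{1..ncon S i}. power_use S i k (W $ i) \<le> \<beta> * qlim S i k)}"

definition P1_value ::
  "('c::finite, 'u::finite, 't::finite) downlink \<Rightarrow> ('c \<Rightarrow> 'u \<Rightarrow> real) \<Rightarrow> real" where
  "P1_value S \<gamma> = (INF (\<beta>, W)\<in>P1_feasible S \<gamma>. \<beta>)"

definition P1_optimal ::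
  "('c::finite, 'u::finite, 't::finite) downlink \<Rightarrow> ('c \<Rightarrow> 'u \<Rightarrow> real)
    \<Rightarrow> real \<Rightarrow> complex^'u^'t^'c \<Rightarrow> bool" where
  "P1_optimal S \<gamma> \<beta> W \<longleftrightarrow>
     (\<beta>, W) \<in> P1_feasible S \<gamma> \<and> (\<forall>(\<beta>', W')\<in>P1_feasible S \<gamma>. \<beta> \<le> \<beta>')"

definition targets :: "('c \<Rightarrow> 'u \<Rightarrow> real) \<Rightarrow> ('c \<Rightarrow> 'u \<Rightarrow> real) \<Rightarrow> real \<Rightarrow> 'c \<Rightarrow> 'u \<Rightarrow> real" where
  "targets a \<alpha> f = (\<lambda>i j. a i j + \<alpha> i j * f)"

definition accepts ::
  "('c::finite, 'u::finite, 't::finite) downlink \<Rightarrow> ('c \<Rightarrow> 'u \<Rightarrow> real) \<Rightarrow> ('c \<Rightarrow> 'u \<Rightarrow> real)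
    \<Rightarrow> real \<Rightarrow> bool" where
  "accepts S a \<alpha> f \<longleftrightarrow>
     P1_feasible S (targets a \<alpha> f) \<noteq> {} \<and> P1_value S (targets a \<alpha> f) \<le> 1"

text \<open>The search sets are intervals, possibly half-open; their midpoint is taken between
  infimum and supremum.\<close>

definition candidate :: "real set \<Rightarrow> real" where
  "candidate F = (Inf F + Sup F) / 2"

definition bisect_step ::
  "('c::finite, 'u::finite, 't::finite) downlink \<Rightarrow> ('c \<Rightarrow> 'u \<Rightarrow> real) \<Rightarrow> ('c \<Rightarrow> 'u \<Rightarrow> real)
    \<Rightarrow> real set \<Rightarrow> real set" where
  "bisect_step S a \<alpha> F =
     (if accepts S a \<alpha> (candidate F)
      then F - {f. f < candidate F}
      else F - {f. f \<ge> candidate F})"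

definition search_set ::
  "('c::finite, 'u::finite, 't::finite) downlink \<Rightarrow> ('c \<Rightarrow> 'u \<Rightarrow> real) \<Rightarrow> ('c \<Rightarrow> 'u \<Rightarrow> real)
    \<Rightarrow> real \<Rightarrow> nat \<Rightarrow> real set" where
  "search_set S a \<alpha> f_upper n = (bisect_step S a \<alpha> ^^ n) {0..f_upper}"

end

theory Submission
  imports Defs
begin

text \<open>
  Since \<open>\<Sum>\<^sub>k Q\<^sub>i\<^sub>k\<close> is positive definite and the distortion terms only add power, bounding \<open>\<beta>\<close> bounds
  the beamforming matrices, and SINR is continuous because its denominator is at least \<open>\<sigma>\<^sup>2\<close>.
  Hence the sublevel sets of (P1), and with them the feasible set of (P2), are compact, and both
  optima are attained. An optimal point of (P2), with \<open>\<beta> = 1\<close>, is feasible for (P1) at every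
  candidate \<open>f\<close> up to the optimal value; conversely an optimal point of (P1) with \<open>\<beta> \<le> 1\<close> has
  objective at least \<open>f\<close> in (P2). So \<open>f\<close> is accepted exactly when it does not exceed the optimal
  value of (P2), and each step halves an interval containing that value.
\<close>

section \<open>Finite minima and real intervals\<close>

lemma continuous_on_Min_image:
  fixes f :: "'i \<Rightarrow> 'a::topological_space \<Rightarrow> 'b::linorder_topology"
  assumes "finite I" "I \<noteq> {}" "\<And>i. i \<in> I \<Longrightarrow> continuous_on X (f i)"
  shows "continuous_on X (\<lambda>x. Min ((\<lambda>i. f i x) ` I))"
  using assms
proof (induction rule: finite_ne_induct)
  case (singleton i)
  then show ?case by simp
next
  case (insert i I)
  then have "continuous_on X (\<lambda>x. min (f i x) (Min ((\<lambda>i. f i x) ` I)))"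
    by (intro continuous_on_min) auto
  then show ?case
    using insert.hyps by simp
qed

text \<open>The member \<open>v\<close> rules out the empty set, on which \<open>Inf\<close> and
  \<open>Sup\<close> carry no information; density of the reals gives the supremum in the half-open
  case.\<close>

lemma interval_bounds_real:
  fixes F :: "real set"
  assumes "F = {l..u} \<or> F = {l..<u}" "v \<in> F"
  shows "Inf F = l" "Sup F = u" "F \<subseteq> {l..u}"
  using assms by auto

section \<open>Hermitian forms, traces and the distortion covariance\<close>

lemma continuous_on_herm_prod [continuous_intros]:
  "continuous_on X f \<Longrightarrow> continuous_on X g \<Longrightarrow> continuous_on X (\<lambda>x. herm_prod (f x) (g x))"
  unfolding herm_prod_def by (intro continuous_intros)

lemma herm_prod_matrix_vector:
  "herm_prod x (A *v y) = (\<Sum>a\<in>UNIV. \<Sum>b\<in>UNIV. cnj (x $ a) * A $ a $ b * y $ b)"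
  by (simp add: herm_prod_def matrix_vector_mult_def sum_distrib_left mult.assoc)

lemma herm_prod_zero_right [simp]: "herm_prod x 0 = 0"
  by (simp add: herm_prod_def)

lemma herm_prod_sum_matrix:
  "herm_prod x ((\<Sum>k\<in>K. A k) *v y) = (\<Sum>k\<in>K. herm_prod x (A k *v y))"
proof (cases "finite K")
  case True
  then show ?thesis
  proof (induction K rule: finite_induct)
    case empty
    then show ?case by simp
  next
    case (insert k K)
    then show ?case
      by (simp add: matrix_vector_mult_add_rdistrib herm_prod_def distrib_left sum.distrib)
  qed
qed simp

text \<open>The form is continuous and positive on the compact unit sphere, hence has a positive
  minimum \<open>c\<close> there; homogeneity of degree two carries the bound to all
  vectors.\<close>

lemma pos_def_lower_bound:
  fixes P :: "complex^'n::finite^'n"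
  assumes "pos_def P"
  obtains c where "0 < c" "\<And>x. c * (norm x)\<^sup>2 \<le> Re (herm_prod x (P *v x))"
proof -
  have cont: "continuous_on (sphere 0 1) (\<lambda>x. Re (herm_prod x (P *v x)))"
    unfolding herm_prod_matrix_vector by (intro continuous_intros)
  have "sphere 0 1 \<noteq> ({} :: (complex^'n) set)"
    using vector_choose_size[of 1, where 'a = "complex^'n"] by auto
  from continuous_attains_inf[OF compact_sphere this cont]
  obtain u :: "complex^'n" where u: "norm u = 1"
    and min: "\<And>y. norm y = 1 \<Longrightarrow> Re (herm_prod u (P *v u)) \<le> Re (herm_prod y (P *v y))"
    by auto
  define c where "c = Re (herm_prod u (P *v u))"
  show ?thesis
  proof
    from u have "u \<noteq> 0" by auto
    then show "0 < c" using assms by (simp add: c_def pos_def_def)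
    fix x :: "complex^'n"
    show "c * (norm x)\<^sup>2 \<le> Re (herm_prod x (P *v x))"
    proof (cases "x = 0")
      case False
      define y where "y = (1 / norm x) *\<^sub>R x"
      have x: "x = norm x *\<^sub>R y" and y: "norm y = 1" using False by (auto simp: y_def)
      \<comment> \<open>The equation \<open>x\<close> has \<open>x\<close> on its right side too;
        only the two arguments of the form are rewritten, so that \<open>norm x\<close> stays
        intact.\<close>
      have "herm_prod x (P *v x) = of_real ((norm x)\<^sup>2) * herm_prod y (P *v y)"
        by (subst (1 2) x)
          (simp add: herm_prod_matrix_vector sum_distrib_left power2_eq_square
            scaleR_conv_of_real[where ?'a = complex] mult_ac)
      then have "Re (herm_prod x (P *v x)) = (norm x)\<^sup>2 * Re (herm_prod y (P *v y))"
        by simp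
      with mult_right_mono[OF min[OF y], of "(norm x)\<^sup>2"] show ?thesis
        by (simp add: c_def mult.commute)
    qed simp
  qed
qed

text \<open>Each diagonal entry of the congruence is the form of \<open>A\<close> at one column of
  \<open>V\<close>, so definiteness of \<open>A\<close> can be applied column by column.\<close>

lemma trace_congruence:
  "trace (conj_transpose V ** A ** V) = (\<Sum>j\<in>UNIV. herm_prod (column j V) (A *v column j V))"
  unfolding trace_def matrix_matrix_mult_def conj_transpose_def herm_prod_matrix_vector column_def
  by (simp add: sum_distrib_right) (rule sum.cong[OF refl], rule sum.swap)

text \<open>The library norm sums over rows first, so the double sum of squared moduli has to be
  exchanged.\<close>

lemma norm_matrix_columns:
  fixes V :: "complex^'u::finite^'t::finite"
  shows "(norm V)\<^sup>2 = (\<Sum>j\<in>UNIV. (norm (column j V))\<^sup>2)"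
  unfolding norm_vec_def L2_set_def column_def
  by (simp add: sum_nonneg) (rule sum.swap)

lemma pos_semidef_diag_nonneg:
  fixes A :: "complex^'n::finite^'n"
  assumes "pos_semidef A"
  shows "0 \<le> Re (A $ n $ n)"
proof -
  \<comment> \<open>The unit vector \<open>axis n 1\<close> isolates the diagonal entry.\<close>
  have "herm_prod (axis n 1) (A *v axis n 1) = A $ n $ n"
    by (simp add: herm_prod_def axis_def matrix_vector_mult_def if_distrib if_distribR cong: if_cong)
  then show ?thesis using assms unfolding pos_semidef_def by metis
qed

lemma trace_mult_tx_cov:
  "trace (A ** tx_cov S V) = (\<Sum>n\<in>UNIV. A $ n $ n * of_real ((tx_dist S V n)\<^sup>2))"
  by (simp add: trace_def matrix_matrix_mult_def tx_cov_def if_distrib cong: if_cong)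

text \<open>The covariance is diagonal, so the form becomes a sum of squares; this makes its sign
  and its continuity in the beams visible.\<close>

lemma herm_prod_tx_cov:
  "Re (herm_prod h (tx_cov S V *v h)) = (\<Sum>n\<in>UNIV. (cmod (h $ n))\<^sup>2 * (tx_dist S V n)\<^sup>2)"
proof -
  have "herm_prod h (tx_cov S V *v h)
      = (\<Sum>n\<in>UNIV. of_real ((cmod (h $ n))\<^sup>2 * (tx_dist S V n)\<^sup>2))"
    unfolding herm_prod_def
    by (rule sum.cong)
      (simp_all add: matrix_vector_mult_def tx_cov_def if_distrib if_distribR
        complex_norm_square[simplified] mult_ac cong: if_cong)
  then show ?thesis by simp
qed

section \<open>Continuity and sign of SINR and transmit power\<close>

context
  fixes S :: "('c::finite, 'u::finite, 't::finite) downlink"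
  assumes model: "downlink_model S"
begin

text \<open>Continuity of \<open>eta S\<close> is assumed only on the nonnegative half-line; norms
  take their values there.\<close>

lemma continuous_on_tx_dist: "continuous_on X (\<lambda>V :: complex^'u^'t. tx_dist S V n)"
proof -
  have "continuous_on {0..} (eta S)" using model by (simp add: downlink_model_def)
  then show ?thesis
    unfolding tx_dist_def matrix_matrix_mult_def
    by (rule continuous_on_compose2) (auto intro!: continuous_intros)
qed

lemma continuous_on_rx_var: "continuous_on X (\<lambda>W. rx_var S W i j)"
proof -
  have "continuous_on {0..} (nu S)" using model by (simp add: downlink_model_def)
  then have "continuous_on X (\<lambda>W. nu S (sqrt (\<Sum>m\<in>UNIV. (norm (conj_vec (chan S m i j) v* (W $ m)))\<^sup>2)))"
    unfolding vector_matrix_mult_def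
    by (rule continuous_on_compose2) (auto intro!: continuous_intros sum_nonneg)
  then show ?thesis unfolding rx_var_def by (intro continuous_intros)
qed

text \<open>The thermal noise is positive and all other terms are sums of squares, so the SINR
  denominator never vanishes.\<close>

lemma interference_pos:
  "0 < (\<Sum>l\<in>UNIV - {j}. (cmod (herm_prod (chan S i i j) (column l (W $ i))))\<^sup>2)
      + (\<Sum>m\<in>UNIV - {i}. (norm (conj_vec (chan S m i j) v* (W $ m)))\<^sup>2)
      + (\<Sum>m\<in>UNIV. Re (herm_prod (chan S m i j) (tx_cov S (W $ m) *v chan S m i j)))
      + rx_var S W i j"
proof -
  have "0 < rx_var S W i j"
    using model by (simp add: rx_var_def downlink_model_def add_pos_nonneg)
  then show ?thesis
    by (intro add_nonneg_pos add_nonneg_nonneg sum_nonneg) (auto simp: herm_prod_tx_cov sum_nonneg)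
qed

lemma SINR_nonneg: "0 \<le> SINR S W i j"
  unfolding SINR_def using interference_pos[of i j W] by simp

lemma continuous_on_SINR: "continuous_on X (\<lambda>W. SINR S W i j)"
proof -
  have "continuous_on X (\<lambda>W. tx_dist S (W $ m) n)" for m :: 'c and n :: 't and X :: "(complex^'u^'t^'c) set"
    by (rule continuous_on_compose2[OF continuous_on_tx_dist[of UNIV]]) (auto intro!: continuous_intros)
  then show ?thesis
    \<comment> \<open>The positivity fact is unfolded in the same way as the goal, so that it
      matches the side condition of the division rule.\<close>
    unfolding SINR_def herm_prod_tx_cov column_def vector_matrix_mult_def
    by (intro continuous_on_divide continuous_intros continuous_on_rx_var ballI
        less_imp_neq[THEN not_sym]
        interference_pos[unfolded herm_prod_tx_cov column_def vector_matrix_mult_def])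
qed

lemma continuous_on_perf_SINR: "continuous_on X (\<lambda>W. perf S i j (SINR S W i j))"
proof -
  have "continuous_on {0..} (perf S i j)" using model by (simp add: downlink_model_def)
  then show ?thesis
    by (rule continuous_on_compose2) (auto simp: SINR_nonneg intro: continuous_on_SINR)
qed

lemma continuous_on_power_use: "continuous_on X (\<lambda>V. power_use S i k (V :: complex^'u^'t))"
  unfolding power_use_def trace_congruence trace_mult_tx_cov herm_prod_matrix_vector column_def
  by (intro continuous_intros continuous_on_tx_dist)

text \<open>A positive semidefinite matrix has a nonnegative diagonal, so the distortion trace is
  nonnegative and dropping it only lowers the power.\<close>

lemma power_use_ge_quadratic:
  assumes "k \<in> {1..ncon S i}"
  shows "(\<Sum>j\<in>UNIV. Re (herm_prod (column j V) (Qmat S i k *v column j V)))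
    \<le> power_use S i k (V :: complex^'u^'t)"
proof -
  have "pos_semidef (Qmat S i k)" "0 \<le> delta S"
    using model assms by (auto simp: downlink_model_def)
  then have "0 \<le> delta S * Re (trace (Qmat S i k ** tx_cov S V))"
    by (auto simp: trace_mult_tx_cov intro!: mult_nonneg_nonneg sum_nonneg pos_semidef_diag_nonneg)
  then show ?thesis by (simp add: power_use_def trace_congruence)
qed

lemma power_use_nonneg:
  assumes "k \<in> {1..ncon S i}"
  shows "0 \<le> power_use S i k (V :: complex^'u^'t)"
proof -
  have "pos_semidef (Qmat S i k)" using model assms by (auto simp: downlink_model_def)
  then show ?thesis
    by (intro order_trans[OF _ power_use_ge_quadratic[OF assms]] sum_nonneg) (auto simp: pos_semidef_def)
qed

section \<open>Compactness of the feasible sets and optima of (P1)\<close>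

lemma ncon_pos: "1 \<le> ncon S i"
proof (rule ccontr)
  assume "\<not> 1 \<le> ncon S i"
  \<comment> \<open>Without constraints the sum of the \<open>Qmat S i k\<close> is empty, hence the
    zero matrix.\<close>
  then have "pos_def (0 :: complex^'t^'t)"
    using model by (auto simp: downlink_model_def dest: spec[of _ i])
  moreover obtain x :: "complex^'t" where "x \<noteq> 0"
    using vector_choose_size[of 1, where 'a = "complex^'t"] by force
  ultimately show False by (auto simp: pos_def_def)
qed

lemma P1_feasible_nonneg:
  assumes "(\<beta>, W) \<in> P1_feasible S \<gamma>"
  shows "0 \<le> \<beta>"
proof -
  \<comment> \<open>Types are inhabited, so some cell exists; its first constraint already bounds
    \<open>\<beta>\<close> from below.\<close>
  fix i :: 'c
  have k: "1 \<in> {1..ncon S i}" using ncon_pos[of i] by simp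
  then have "power_use S i 1 (W $ i) \<le> \<beta> * qlim S i 1"
    using assms by (auto simp: P1_feasible_def)
  with power_use_nonneg[OF k, of "W $ i"] have "0 \<le> \<beta> * qlim S i 1" by linarith
  moreover have "0 < qlim S i 1" using model k by (auto simp: downlink_model_def)
  ultimately show ?thesis by (simp add: zero_le_mult_iff)
qed

text \<open>Adding the constraints of a cell produces the form of the positive definite sum of the
  \<open>Qmat S i k\<close>, which dominates a multiple of the squared Frobenius norm.\<close>

lemma power_bounded_cell:
  obtains R where "\<And>V :: complex^'u^'t.
    (\<And>k. k \<in> {1..ncon S i} \<Longrightarrow> power_use S i k V \<le> B * qlim S i k) \<Longrightarrow> norm V \<le> R"
proof -
  define P where "P = (\<Sum>k=1..ncon S i. Qmat S i k)"
  have "pos_def P" using model by (simp add: downlink_model_def P_def)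
  then obtain c where c: "0 < c" "\<And>x. c * (norm x)\<^sup>2 \<le> Re (herm_prod x (P *v x))"
    by (rule pos_def_lower_bound) blast
  \<comment> \<open>\<open>M\<close> is the total power limit at scaling \<open>B\<close>; the
    radius is \<open>sqrt (M / c)\<close>.\<close>
  define M where "M = (\<Sum>k=1..ncon S i. B * qlim S i k)"
  have "norm V \<le> sqrt (M / c)"
    if V: "\<And>k. k \<in> {1..ncon S i} \<Longrightarrow> power_use S i k V \<le> B * qlim S i k" for V :: "complex^'u^'t"
  proof -
    have "c * (norm V)\<^sup>2 = (\<Sum>j\<in>UNIV. c * (norm (column j V))\<^sup>2)"
      by (simp add: norm_matrix_columns sum_distrib_left)
    also have "\<dots> \<le> (\<Sum>j\<in>UNIV. Re (herm_prod (column j V) (P *v column j V)))"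
      by (intro sum_mono c)
    also have "\<dots> = (\<Sum>k=1..ncon S i. \<Sum>j\<in>UNIV. Re (herm_prod (column j V) (Qmat S i k *v column j V)))"
      unfolding P_def herm_prod_sum_matrix Re_sum by (rule sum.swap)
    also have "\<dots> \<le> M"
      unfolding M_def by (intro sum_mono order_trans[OF power_use_ge_quadratic V])
    finally have "(norm V)\<^sup>2 \<le> M / c" using c by (simp add: field_simps)
    then show ?thesis by (rule real_le_rsqrt)
  qed
  then show ?thesis by (rule that)
qed

text \<open>Raising \<open>\<beta>\<close> keeps a point feasible, so compactness needs the cut at
  \<open>B\<close>. The power constraints then bound the set, and continuity of all constraint
  functions makes it closed.\<close>

lemma compact_P1_feasible_sublevel:
  "compact (P1_feasible S \<gamma> \<inter> {..B} \<times> UNIV)"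
proof (rule compact_eq_bounded_closed[THEN iffD2], intro conjI)
  have "\<exists>R. \<forall>V :: complex^'u^'t.
      (\<forall>k\<in>{1..ncon S i}. power_use S i k V \<le> B * qlim S i k) \<longrightarrow> norm V \<le> R" for i
    by (rule power_bounded_cell[of i B]) blast
  then obtain R where R: "\<And>i (V :: complex^'u^'t).
      (\<forall>k\<in>{1..ncon S i}. power_use S i k V \<le> B * qlim S i k) \<Longrightarrow> norm V \<le> R i"
    by metis
  have "norm p \<le> \<bar>B\<bar> + (\<Sum>i\<in>UNIV. R i)" if p: "p \<in> P1_feasible S \<gamma> \<inter> {..B} \<times> UNIV" for p
  proof -
    obtain \<beta> W where [simp]: "p = (\<beta>, W)" by (cases p)
    have \<beta>: "0 \<le> \<beta>" "\<beta> \<le> B" using p P1_feasible_nonneg[of \<beta> W \<gamma>] by auto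
    have "norm (W $ i) \<le> R i" for i
    proof (rule R, rule ballI)
      fix k assume k: "k \<in> {1..ncon S i}"
      then have "power_use S i k (W $ i) \<le> \<beta> * qlim S i k"
        using p by (auto simp: P1_feasible_def)
      also have "\<dots> \<le> B * qlim S i k"
        using model k \<beta> by (intro mult_right_mono) (auto simp: downlink_model_def less_imp_le)
      finally show "power_use S i k (W $ i) \<le> B * qlim S i k" .
    qed
    then have "(\<Sum>i\<in>UNIV. norm (W $ i)) \<le> (\<Sum>i\<in>UNIV. R i)" by (rule sum_mono)
    then have "norm W \<le> (\<Sum>i\<in>UNIV. R i)"
      unfolding norm_vec_def[of W] by (rule order_trans[OF L2_set_le_sum, rotated]) simp
    then show ?thesis using norm_Pair_le[of \<beta> W] \<beta> by simp
  qed
  then show "bounded (P1_feasible S \<gamma> \<inter> {..B} \<times> UNIV)" by (auto simp: bounded_iff)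
  have perf: "continuous_on UNIV (\<lambda>p. perf S i j (SINR S (snd p) i j))" for i j
    by (rule continuous_on_compose2[OF continuous_on_perf_SINR[of UNIV]]) (auto intro!: continuous_intros)
  have power: "continuous_on UNIV (\<lambda>p :: real \<times> (complex^'u^'t^'c). power_use S i k (snd p $ i))" for i k
    by (rule continuous_on_compose2[OF continuous_on_power_use[of UNIV]]) (auto intro!: continuous_intros)
  have "P1_feasible S \<gamma> =
      (\<Inter>i. \<Inter>j. {p. \<gamma> i j \<le> perf S i j (SINR S (snd p) i j)}) \<inter>
      (\<Inter>i. \<Inter>k\<in>{1..ncon S i}. {p. power_use S i k (snd p $ i) \<le> fst p * qlim S i k})"
    by (auto simp: P1_feasible_def)
  also have "closed \<dots>"
    by (intro closed_Int closed_INT ballI closed_Collect_le perf power continuous_intros)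
  finally show "closed (P1_feasible S \<gamma> \<inter> {..B} \<times> UNIV)"
    by (intro closed_Int closed_Times) auto
qed

text \<open>As the limits are positive, a scaling \<open>\<beta> \<le> 1\<close> only tightens the
  power constraints, and \<open>\<beta> = 1\<close> gives those of (P2). The feasible set of (P2) is
  thus a projection of a compact set.\<close>

lemma P2_feasible_eq: "P2_feasible S a = snd ` (P1_feasible S a \<inter> {..1} \<times> UNIV)"
proof (intro equalityI subsetI)
  fix W assume "W \<in> P2_feasible S a"
  then have "(1, W) \<in> P1_feasible S a \<inter> {..1} \<times> UNIV"
    by (auto simp: P2_feasible_def P1_feasible_def feasible_beams_def)
  then show "W \<in> snd ` (P1_feasible S a \<inter> {..1} \<times> UNIV)" by (metis image_eqI snd_conv)
next
  fix W assume "W \<in> snd ` (P1_feasible S a \<inter> {..1} \<times> UNIV)"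
  then obtain \<beta> where W: "(\<beta>, W) \<in> P1_feasible S a" "\<beta> \<le> 1" by auto
  have "power_use S i k (W $ i) \<le> qlim S i k" if k: "k \<in> {1..ncon S i}" for i k
  proof -
    have "power_use S i k (W $ i) \<le> \<beta> * qlim S i k" using W k by (auto simp: P1_feasible_def)
    also have "\<dots> \<le> 1 * qlim S i k"
      using model k W by (intro mult_right_mono) (auto simp: downlink_model_def less_imp_le)
    finally show ?thesis by simp
  qed
  then show "W \<in> P2_feasible S a"
    using W by (auto simp: P2_feasible_def P1_feasible_def feasible_beams_def)
qed

lemma compact_P2_feasible: "compact (P2_feasible S a)"
  unfolding P2_feasible_eq by (intro compact_continuous_image compact_P1_feasible_sublevel continuous_intros)

text \<open>Any feasible point, of scaling \<open>\<beta>0\<close> say, confines the search to a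
  compact sublevel set; feasible points outside it have larger scaling.\<close>

lemma P1_optimal_exists:
  assumes "P1_feasible S \<gamma> \<noteq> {}"
  obtains \<beta> W where "P1_optimal S \<gamma> \<beta> W"
proof -
  from assms obtain \<beta>0 W0 where 0: "(\<beta>0, W0) \<in> P1_feasible S \<gamma>" by auto
  then have "P1_feasible S \<gamma> \<inter> {..\<beta>0} \<times> UNIV \<noteq> {}" by auto
  from continuous_attains_inf[OF compact_P1_feasible_sublevel this continuous_on_fst[OF continuous_on_id]]
  obtain q where q: "q \<in> P1_feasible S \<gamma> \<inter> {..\<beta>0} \<times> UNIV"
    and min: "\<And>p. p \<in> P1_feasible S \<gamma> \<inter> {..\<beta>0} \<times> UNIV \<Longrightarrow> fst q \<le> fst p"
    by blast
  have "fst q \<le> fst p" if "p \<in> P1_feasible S \<gamma>" for p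
  proof (cases "fst p \<le> \<beta>0")
    case True
    with that show ?thesis by (intro min) (cases p, auto)
  qed (use q in auto)
  with q have "P1_optimal S \<gamma> (fst q) (snd q)"
    by (auto simp: P1_optimal_def)
  then show ?thesis by (rule that)
qed

lemma P1_optimal_value:
  assumes "P1_optimal S \<gamma> \<beta> W"
  shows "P1_value S \<gamma> = \<beta>"
proof -
  have "P1_value S \<gamma> = Inf (fst ` P1_feasible S \<gamma>)"
    unfolding P1_value_def by (simp add: case_prod_beta' fst_def[symmetric])
  also have "\<dots> = \<beta>"
    by (rule cInf_eq_minimum) (use assms in \<open>force simp: P1_optimal_def\<close>)+
  finally show ?thesis .
qed

section \<open>The value of (P2), the acceptance test and the bisection invariant\<close>

context
  fixes a \<alpha> :: "'c \<Rightarrow> 'u \<Rightarrow> real"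
  assumes alpha_nonneg: "\<And>i j. 0 \<le> \<alpha> i j"
    and alpha_sum: "(\<Sum>i\<in>UNIV. \<Sum>j\<in>UNIV. \<alpha> i j) = 1"
begin

text \<open>Ensures that the \<open>Min\<close> in the objective is taken over a nonempty
  set.\<close>

lemma alpha_support_nonempty: "{(i, j). \<alpha> i j \<noteq> 0} \<noteq> {}"
proof
  assume "{(i, j). \<alpha> i j \<noteq> 0} = {}"
  then have "\<And>i j. \<alpha> i j = 0" by auto
  then show False using alpha_sum by simp
qed

text \<open>Clearing the positive weight gives the epigraph form of the max-min objective, which
  links (P2) to the targets of (P1).\<close>

lemma P2_objective_ge_iff:
  "f \<le> P2_objective S a \<alpha> W \<longleftrightarrow>
     (\<forall>i j. \<alpha> i j \<noteq> 0 \<longrightarrow> targets a \<alpha> f i j \<le> perf S i j (SINR S W i j))"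
proof -
  have "f \<le> (p - a i j) / \<alpha> i j \<longleftrightarrow> targets a \<alpha> f i j \<le> p" if "\<alpha> i j \<noteq> 0" for i j p
    using that alpha_nonneg[of i j] by (auto simp: targets_def field_simps)
  then show ?thesis
    unfolding P2_objective_def using alpha_support_nonempty by (subst Min_ge_iff) auto
qed

lemma continuous_on_P2_objective: "continuous_on X (P2_objective S a \<alpha>)"
proof -
  have "continuous_on X (\<lambda>W. Min ((\<lambda>p. (case p of (i, j) \<Rightarrow>
      (perf S i j (SINR S W i j) - a i j) / \<alpha> i j)) ` {(i, j). \<alpha> i j \<noteq> 0}))"
    by (intro continuous_on_Min_image alpha_support_nonempty)
      (auto intro!: continuous_on_divide continuous_on_diff continuous_on_perf_SINR continuous_on_const)
  then show ?thesis unfolding P2_objective_def .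
qed

lemma P2_value_attained:
  assumes "P2_feasible S a \<noteq> {}"
  obtains W where "W \<in> P2_feasible S a" "P2_objective S a \<alpha> W = P2_value S a \<alpha>"
    "\<And>W'. W' \<in> P2_feasible S a \<Longrightarrow> P2_objective S a \<alpha> W' \<le> P2_value S a \<alpha>"
proof -
  from continuous_attains_sup[OF compact_P2_feasible assms continuous_on_P2_objective]
  obtain W where W: "W \<in> P2_feasible S a"
    "\<And>W'. W' \<in> P2_feasible S a \<Longrightarrow> P2_objective S a \<alpha> W' \<le> P2_objective S a \<alpha> W" by blast
  then have "P2_value S a \<alpha> = P2_objective S a \<alpha> W"
    unfolding P2_value_def by (intro cSup_eq_maximum) auto
  with W that show ?thesis by auto
qed

text \<open>At \<open>f = 0\<close> the targets are \<open>a\<close> itself, which feasibility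
  grants. The optimal value thus respects the left end of the initial interval.\<close>

lemma P2_value_nonneg:
  assumes "P2_feasible S a \<noteq> {}"
  shows "0 \<le> P2_value S a \<alpha>"
proof -
  obtain W where W: "W \<in> P2_feasible S a" "P2_objective S a \<alpha> W = P2_value S a \<alpha>"
    using P2_value_attained[OF assms] by metis
  then have "0 \<le> P2_objective S a \<alpha> W"
    by (subst P2_objective_ge_iff) (auto simp: P2_feasible_def targets_def)
  with W show ?thesis by simp
qed

text \<open>For \<open>0 \<le> f\<close> the targets are at least \<open>a\<close>, and acceptance
  puts the optimal scaling at or below 1; so the constraints of (P1) imply those of (P2).\<close>

lemma accepted_P1_optimal:
  assumes "0 \<le> f" "accepts S a \<alpha> f" "P1_optimal S (targets a \<alpha> f) \<beta> W"
  shows "W \<in> P2_feasible S a" "f \<le> P2_objective S a \<alpha> W"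
proof -
  have W: "(\<beta>, W) \<in> P1_feasible S (targets a \<alpha> f)"
    using assms(3) by (simp add: P1_optimal_def)
  have \<beta>: "\<beta> \<le> 1"
    using assms(2) P1_optimal_value[OF assms(3)] by (simp add: accepts_def)
  have "a i j \<le> perf S i j (SINR S W i j)" for i j
  proof -
    have "a i j \<le> targets a \<alpha> f i j"
      using assms(1) alpha_nonneg[of i j] by (simp add: targets_def)
    also have "\<dots> \<le> perf S i j (SINR S W i j)"
      using W by (simp add: P1_feasible_def)
    finally show ?thesis .
  qed
  then have "(\<beta>, W) \<in> P1_feasible S a \<inter> {..1} \<times> UNIV"
    using W \<beta> by (simp add: P1_feasible_def)
  then show "W \<in> P2_feasible S a" unfolding P2_feasible_eq by (metis image_eqI snd_conv)
  show "f \<le> P2_objective S a \<alpha> W"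
    using W by (simp add: P2_objective_ge_iff P1_feasible_def)
qed

lemma accepts_iff:
  assumes "P2_feasible S a \<noteq> {}" "0 \<le> f"
  shows "accepts S a \<alpha> f \<longleftrightarrow> f \<le> P2_value S a \<alpha>"
proof
  assume acc: "accepts S a \<alpha> f"
  then have "P1_feasible S (targets a \<alpha> f) \<noteq> {}" by (simp add: accepts_def)
  then obtain \<beta> W where "P1_optimal S (targets a \<alpha> f) \<beta> W"
    by (rule P1_optimal_exists)
  from accepted_P1_optimal[OF assms(2) acc this] P2_value_attained[OF assms(1)]
  show "f \<le> P2_value S a \<alpha>" by (metis order_trans)
next
  assume f: "f \<le> P2_value S a \<alpha>"
  obtain W where W: "W \<in> P2_feasible S a" "P2_objective S a \<alpha> W = P2_value S a \<alpha>"
    using P2_value_attained[OF assms(1)] by metis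
  with f have "f \<le> P2_objective S a \<alpha> W" by simp
  \<comment> \<open>A pair of weight zero is invisible to the objective, but its target is just
    \<open>a i j\<close>, which feasibility grants.\<close>
  then have "targets a \<alpha> f i j \<le> perf S i j (SINR S W i j)" for i j
    using W(1) by (cases "\<alpha> i j = 0") (auto simp: P2_objective_ge_iff P2_feasible_def targets_def)
  then have feas: "(1, W) \<in> P1_feasible S (targets a \<alpha> f)"
    using W(1) by (auto simp: P1_feasible_def P2_feasible_def feasible_beams_def)
  then obtain \<beta> V where opt: "P1_optimal S (targets a \<alpha> f) \<beta> V"
    using P1_optimal_exists by blast
  with feas have "\<beta> \<le> 1" by (auto simp: P1_optimal_def)
  with feas P1_optimal_value[OF opt] show "accepts S a \<alpha> f" by (auto simp: accepts_def)
qed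

text \<open>Both shapes occur because a rejection opens the right end. The bound
  \<open>0 \<le> l\<close> keeps every candidate within the scope of \<open>accepts_iff\<close>, and
  the exact length gives convergence.\<close>

lemma search_set_interval:
  assumes "P2_feasible S a \<noteq> {}" "P2_value S a \<alpha> \<le> f_upper"
  shows "\<exists>l u. (search_set S a \<alpha> f_upper n = {l..u} \<or> search_set S a \<alpha> f_upper n = {l..<u}) \<and>
    P2_value S a \<alpha> \<in> search_set S a \<alpha> f_upper n \<and> 0 \<le> l \<and> u - l = f_upper / 2 ^ n"
proof (induction n)
  case 0
  show ?case
    using P2_value_nonneg[OF assms(1)] assms(2)
    by (intro exI[of _ 0] exI[of _ f_upper]) (simp add: search_set_def)
next
  case (Suc n)
  define F where "F = search_set S a \<alpha> f_upper n"
  define v where "v = P2_value S a \<alpha>"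
  from Suc obtain l u where F: "F = {l..u} \<or> F = {l..<u}" and v: "v \<in> F"
    and l: "0 \<le> l" and len: "u - l = f_upper / 2 ^ n"
    by (auto simp: F_def v_def)
  note bounds = interval_bounds_real[OF F v]
  have le: "l \<le> v" "v \<le> u" using bounds(3) v by auto
  have cand: "candidate F = (l + u) / 2" by (simp add: candidate_def bounds)
  have acc: "accepts S a \<alpha> ((l + u) / 2) \<longleftrightarrow> (l + u) / 2 \<le> v"
    unfolding v_def using l le by (intro accepts_iff assms) auto
  have step: "search_set S a \<alpha> f_upper (Suc n) = bisect_step S a \<alpha> F"
    by (simp add: search_set_def F_def)
  have "(u - l) / 2 = f_upper / 2 ^ Suc n" using len by simp
  then have half: "u - (l + u) / 2 = f_upper / 2 ^ Suc n" "(l + u) / 2 - l = f_upper / 2 ^ Suc n"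
    by (simp_all add: field_simps)
  have pos: "0 \<le> (l + u) / 2" using l le by simp
  show ?case
  proof (cases "(l + u) / 2 \<le> v")
    case True
    then have eq: "bisect_step S a \<alpha> F = F - {f. f < (l + u) / 2}"
      by (simp add: bisect_step_def cand acc)
    have "F - {f. f < (l + u) / 2} = {(l + u) / 2..u} \<or> F - {f. f < (l + u) / 2} = {(l + u) / 2..<u}"
      using F le by auto
    moreover have "v \<in> F - {f. f < (l + u) / 2}" using v True by auto
    ultimately show ?thesis
      unfolding step eq v_def[symmetric] using pos half(1) by blast
  next
    case False
    then have eq: "bisect_step S a \<alpha> F = F - {f. f \<ge> (l + u) / 2}"
      by (simp only: bisect_step_def cand acc if_False)
    \<comment> \<open>The midpoint does not exceed \<open>u\<close>, so it becomes the new open end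
      whichever shape \<open>F\<close> had.\<close>
    have "F - {f. f \<ge> (l + u) / 2} = {l..<(l + u) / 2}"
      using F le by auto
    moreover have "v \<in> F - {f. f \<ge> (l + u) / 2}" using v False by auto
    ultimately show ?thesis
      unfolding step eq v_def[symmetric] using l half(2) by blast
  qed
qed

end

end

section \<open>Convergence of the bisection and use of accepted candidates\<close>

theorem corollary1:
  fixes S :: "('c::finite, 'u::finite, 't::finite) downlink"
    and a \<alpha> :: "'c \<Rightarrow> 'u \<Rightarrow> real"
    and f_upper :: real
  assumes "downlink_model S"
    and "convex_on {0..} (eta S)" and "convex_on {0..} (nu S)"
    and "\<And>i j. 0 \<le> a i j" and "\<And>i j. 0 \<le> \<alpha> i j"
    and "(\<Sum>i\<in>UNIV. \<Sum>j\<in>UNIV. \<alpha> i j) = 1"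
    and "P2_feasible S a \<noteq> {}"
    and "P2_value S a \<alpha> \<le> f_upper"
  shows
    "(\<exists>W\<in>P2_feasible S a. P2_objective S a \<alpha> W = P2_value S a \<alpha> \<and>
        (\<forall>W'\<in>P2_feasible S a. P2_objective S a \<alpha> W' \<le> P2_value S a \<alpha>)) \<and>
     (\<forall>n. P2_value S a \<alpha> \<in> search_set S a \<alpha> f_upper n) \<and>
     (\<Inter>n. search_set S a \<alpha> f_upper n) = {P2_value S a \<alpha>} \<and>
     (\<lambda>n. Inf (search_set S a \<alpha> f_upper n)) \<longlonglongrightarrow> P2_value S a \<alpha> \<and>
     (\<lambda>n. Sup (search_set S a \<alpha> f_upper n)) \<longlonglongrightarrow> P2_value S a \<alpha> \<and>
     (\<forall>n. let f = candidate (search_set S a \<alpha> f_upper n) in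
        accepts S a \<alpha> f \<longrightarrow>
          (\<exists>\<beta> W. P1_optimal S (targets a \<alpha> f) \<beta> W) \<and>
          (\<forall>\<beta> W. P1_optimal S (targets a \<alpha> f) \<beta> W \<longrightarrow>
             W \<in> P2_feasible S a \<and> f \<le> P2_objective S a \<alpha> W))"
proof -
  define v where "v = P2_value S a \<alpha>"
  define F where "F = search_set S a \<alpha> f_upper"
  note ctx = assms(1) assms(5,6)
  have F: "\<exists>l u. (F n = {l..u} \<or> F n = {l..<u}) \<and> v \<in> F n \<and> 0 \<le> l \<and> u - l = f_upper / 2 ^ n" for n
    unfolding F_def v_def by (rule search_set_interval[OF ctx assms(7,8)])
  then have v: "v \<in> F n" for n by blast
  \<comment> \<open>In the half-open case \<open>Sup (F n)\<close> lies outside \<open>F n\<close>,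
    so the ends are listed besides the members.\<close>
  have len: "\<bar>x - v\<bar> \<le> f_upper / 2 ^ n" if "x \<in> F n \<or> x = Inf (F n) \<or> x = Sup (F n)" for x n
  proof -
    obtain l u where lu: "F n = {l..u} \<or> F n = {l..<u}" and "u - l = f_upper / 2 ^ n"
      using F[of n] by blast
    note bounds = interval_bounds_real[OF lu v]
    have "l \<le> v" "v \<le> u" using bounds(3) v[of n] by auto
    moreover from this have "l \<le> x" "x \<le> u" using that bounds by auto
    ultimately show ?thesis using \<open>u - l = _\<close> by linarith
  qed
  have cand: "0 \<le> candidate (F n)" for n
  proof -
    obtain l u where lu: "F n = {l..u} \<or> F n = {l..<u}" and "0 \<le> l"
      using F[of n] by blast
    note bounds = interval_bounds_real[OF lu v]
    have "l \<le> u" using bounds(3) v[of n] by auto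
    with \<open>0 \<le> l\<close> show ?thesis by (simp add: candidate_def bounds)
  qed
  have lim0: "(\<lambda>n. f_upper / 2 ^ n) \<longlonglongrightarrow> 0"
    using tendsto_mult_right_zero[OF LIMSEQ_inverse_realpow_zero[of 2], of f_upper]
    by (simp add: divide_inverse)
  have lim: "X \<longlonglongrightarrow> v" if "\<And>n. \<bar>X n - v\<bar> \<le> f_upper / 2 ^ n" for X
    using that by (intro LIM_zero_cancel[OF Lim_null_comparison[OF _ lim0]]) auto
  have "x = v" if "x \<in> (\<Inter>n. F n)" for x
  proof -
    \<comment> \<open>The constant sequence meets the bound in \<open>lim\<close> for every
      \<open>n\<close>; uniqueness of limits then identifies \<open>x\<close> with
      \<open>v\<close>.\<close>
    have "(\<lambda>_ :: nat. x) \<longlonglongrightarrow> v" using that by (intro lim len) auto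
    then show ?thesis by (simp add: LIMSEQ_const_iff)
  qed
  with v have "(\<Inter>n. F n) = {v}" by blast
  moreover have "(\<lambda>n. Inf (F n)) \<longlonglongrightarrow> v" "(\<lambda>n. Sup (F n)) \<longlonglongrightarrow> v" by (auto intro!: lim len)
  moreover have "\<exists>W\<in>P2_feasible S a. P2_objective S a \<alpha> W = v \<and>
      (\<forall>W'\<in>P2_feasible S a. P2_objective S a \<alpha> W' \<le> v)"
    unfolding v_def using P2_value_attained[OF ctx assms(7)] by metis
  moreover have "(\<exists>\<beta> W. P1_optimal S (targets a \<alpha> f) \<beta> W) \<and>
      (\<forall>\<beta> W. P1_optimal S (targets a \<alpha> f) \<beta> W \<longrightarrow> W \<in> P2_feasible S a \<and> f \<le> P2_objective S a \<alpha> W)"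
    if "0 \<le> f" "accepts S a \<alpha> f" for f
    using that accepted_P1_optimal[OF ctx that] P1_optimal_exists[OF assms(1)]
    by (metis accepts_def)
  ultimately show ?thesis
    using v cand unfolding v_def F_def Let_def by blast
qed

end
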